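(* Suppose $f:\mathbb R^n\to\mathbb R$ is $\mu$-strongly convex ($\mu>0$) and $L$-smooth, and let $\mathcal N$ be a linear skew-symmetric operator (a real $n\times n$ matrix with $\mathcal N^{\intercal}=-\mathcal N$). Write $\mathcal N=B^{\intercal}-B$ with $B^{\intercal}=\mathrm{upper}(\mathcal N)$ the upper triangular part of $\mathcal N$, and set $B^{\mathrm{sym}}=B+B^{\intercal}$, $L_{B^{\mathrm{sym}}}=\|B^{\mathrm{sym}}\|$. Let $x^\star$ satisfy $\nabla f(x^\star)+\mathcal N x^\star=0$. Consider the explicit AGSS scheme $$\frac{x_{k+1}-x_k}{\alpha}=2y_{k+1}-y_k-x_{k+1},$$ $$\frac{y_{k+1}-y_k}{\alpha}=x_k-y_{k+1}-\mu^{-1}\big(\nabla f(x_k)+B^{\mathrm{sym}}y_k-2By_{k+1}\big),$$ with initial value $(x_0,y_0)$ and step size $$\alpha=\max_{\beta\in(0,1)}\min\left\{\sqrt{\frac{\beta\mu}{L-\mu}},\ \frac{(1-\beta)\mu}{L_{B^{\mathrm{sym}}}}\right\}.$$ Define $$\mathcal E(x,y)=D_{f_{-\mu}}(x,x^\star)+\frac\mu2\|y-x^\star\|^2,$$ $$\mathcal E^\alpha(x,y)=D_{f_{-\mu}}(x,x^\star)+\frac12\|y-x^\star\|^2_{\mu I-\alpha B^{\mathrm{sym}}}-\alpha\big(\nabla f_{-\mu}(x)-\nabla f_{-\mu}(x^\star),\,y-x^\star\big).$$ Then $\mathcal E^\alpha(x,y)$ serves as the Lyapunov function, and the scheme has the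 accelerated linear convergence $$\mathcal E^\alpha(x_{k+1},y_{k+1})\le\left(\frac1{1+\alpha}\right)^{k+1}\mathcal E^\alpha(x_0,y_0),\qquad k\ge0,$$ and $$\mathcal E(x_{k+1},y_{k+1})\le\frac1\alpha\left(\frac1{1+\alpha}\right)^{k}\mathcal E^\alpha(x_0,y_0),\qquad k\ge0.$$
   Context: $(\cdot,\cdot)$ and $\|\cdot\|$ are the inner product and norm (operator norm for matrices); for a symmetric, possibly indefinite, matrix $A$, $\|x\|_A^2:=(Ax,x)$. $f_{-\mu}(x)=f(x)-\frac\mu2\|x\|^2$; $f$ is $\mu$-strongly convex if $f_{-\mu}$ is convex; $L$-smooth means continuously differentiable with $L$-Lipschitz gradient, $0<L<\infty$. $D_h(y,x)=h(y)-h(x)-(\nabla h(x),y-x)$ is the Bregman divergence of $h$. AGSS stands for accelerated gradient and skew-symmetric splitting; the scheme is a discretization of the flow $x'=y-x$, $y'=-\mu^{-1}(\nabla f(x)-\mu x+\mu y+\mathcal N y)$, whose equilibrium point is $(x^\star,x^\star)$. A Lyapunov function $E(z)$ associated to an ODE $z'=\mathcal G(z)$ with equilibrium point $z^\star$ is described as a function that usually satisfies: (non-negativity) $E(z)\ge0$ for all $z$; (optimality) $E(z)=0$ if and only if $z=z^\star$; (Lyapunov condition) $-\langle\nabla E(z),\mathcal G(z)\rangle\ge0$ for all $z$ near $z^\star$.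
   Formalization: "Lyapunov function" is read for the discrete scheme: (x*,x* ) is a fixed point, E^α is 0 there, E^α≥0, and E^α never increases along a step; that E^α=0 only at (x*,x* ) is not claimed, as it fails (n=2, f=(L/2)|x|², L>μ); the max is a supremum when L=μ or B^sym=0. *)

theory Defs
  imports "HOL-Analysis.Analysis"
begin

section \<open>Smooth and strongly convex functions\<close>

definition gradient :: "('a::real_inner \<Rightarrow> real) \<Rightarrow> 'a \<Rightarrow> 'a" where
  "gradient h x = (THE D. GDERIV h x :> D)"

lemma gradient_eqI:
  assumes "GDERIV h x :> D"
  shows "gradient h x = D"
proof -
  have "D' = D" if "GDERIV h x :> D'" for D'
  proof -
    have "(\<lambda>v. v \<bullet> D') = (\<lambda>v. v \<bullet> D)"
      using assms that has_derivative_unique unfolding gderiv_def by blast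
    then have "v \<bullet> D' = v \<bullet> D" for v by (rule fun_cong)
    then have "(D' - D) \<bullet> (D' - D) = 0"
      by (simp add: inner_diff_right)
    then show ?thesis by simp
  qed
  with assms show ?thesis unfolding gradient_def by blast
qed

text \<open>The function written \<open>f\<^sub>-\<^sub>\<mu>\<close> in the literature.\<close>

definition quad_shift :: "('a::real_inner \<Rightarrow> real) \<Rightarrow> real \<Rightarrow> 'a \<Rightarrow> real" where
  "quad_shift f \<mu> x = f x - \<mu> / 2 * (norm x)\<^sup>2"

definition strongly_convex :: "real \<Rightarrow> ('a::real_inner \<Rightarrow> real) \<Rightarrow> bool" where
  "strongly_convex \<mu> f \<longleftrightarrow> convex_on UNIV (quad_shift f \<mu>)"

text \<open>\<open>L\<close> is any admissible Lipschitz constant of the gradient, not necessarily the least one.\<close>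

definition smooth :: "real \<Rightarrow> ('a::real_inner \<Rightarrow> real) \<Rightarrow> bool" where
  "smooth L f \<longleftrightarrow> 0 < L
     \<and> (\<forall>x. GDERIV f x :> gradient f x)
     \<and> continuous_on UNIV (gradient f)
     \<and> L-lipschitz_on UNIV (gradient f)"

definition bregman :: "('a::real_inner \<Rightarrow> real) \<Rightarrow> 'a \<Rightarrow> 'a \<Rightarrow> real" where
  "bregman h y x = h y - h x - gradient h x \<bullet> (y - x)"


section \<open>Matrices\<close>

type_synonym 'n rvec = "(real, 'n) vec"
type_synonym 'n rmat = "((real, 'n) vec, 'n) vec"

text \<open>
  The operator norm of a matrix is \<open>onorm ((*v) A)\<close>; the library's \<open>norm A\<close> is the Frobenius norm.
\<close>

definition op_norm :: "real^'n^'n \<Rightarrow> real" where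
  "op_norm A = onorm ((*v) A)"

text \<open>\<open>sqnorm_wrt A x\<close> is \<open>\<parallel>x\<parallel>\<^sub>A\<^sup>2\<close>; it can be negative, as \<open>A\<close> may be indefinite.\<close>

definition sqnorm_wrt :: "real^'n^'n \<Rightarrow> real^'n \<Rightarrow> real" where
  "sqnorm_wrt A x = (A *v x) \<bullet> x"

definition skew_symmetric :: "real^'n^'n \<Rightarrow> bool" where
  "skew_symmetric N \<longleftrightarrow> transpose N = - N"

definition upper :: "('n::{finite,linorder}) rmat \<Rightarrow> 'n rmat" where
  "upper N = (\<chi> i j. if i \<le> j then N $ i $ j else 0)"

definition split_B :: "('n::{finite,linorder}) rmat \<Rightarrow> 'n rmat" where
  "split_B N = transpose (upper N)"

definition split_Bsym :: "('n::{finite,linorder}) rmat \<Rightarrow> 'n rmat" where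
  "split_Bsym N = split_B N + transpose (split_B N)"

lemma skew_symmetric_splitting:
  fixes N :: "('n::{finite,linorder}) rmat"
  assumes "skew_symmetric N"
  shows "N = transpose (split_B N) - split_B N"
proof -
  have skew: "N $ j $ i = - N $ i $ j" for i j
  proof -
    have "N $ j $ i = transpose N $ i $ j" by (simp add: transpose_def)
    then show ?thesis using assms by (simp add: skew_symmetric_def)
  qed
  have "N $ i $ i = 0" for i
    using skew[of i i] by simp
  moreover have "upper N $ i $ j - upper N $ j $ i = N $ i $ j" for i j
    using skew[of i j] calculation[of i] by (cases i j rule: linorder_cases) (auto simp: upper_def)
  ultimately show ?thesis
    by (simp add: vec_eq_iff split_B_def transpose_def)
qed


section \<open>The explicit AGSS scheme\<close>

text \<open>
  The two bounds are read as \<open>\<infinity>\<close> when their denominators vanish (\<open>L = \<mu>\<close>, or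
  \<open>B\<^sup>s\<^sup>y\<^sup>m = 0\<close>).  The maximum over \<open>\<beta> \<in> (0,1)\<close> is taken as a supremum in the extended reals:
  when both denominators are positive it is attained (see \<open>agss_step_size_attained\<close>), if exactly
  one vanishes it is the limiting value at \<open>\<beta> = 0\<close> or \<open>\<beta> = 1\<close>; if both vanish it is \<open>\<infinity>\<close>, which is no
  real step size.
\<close>

definition agss_bound :: "real \<Rightarrow> real \<Rightarrow> real \<Rightarrow> real \<Rightarrow> ereal" where
  "agss_bound \<mu> L LB \<beta> =
     min (if L = \<mu> then \<infinity> else ereal (sqrt (\<beta> * \<mu> / (L - \<mu>))))
         (if LB = 0 then \<infinity> else ereal ((1 - \<beta>) * \<mu> / LB))"

definition agss_step_size :: "real \<Rightarrow> real \<Rightarrow> real \<Rightarrow> ereal" where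
  "agss_step_size \<mu> L LB = (SUP \<beta>\<in>{0<..<1}. agss_bound \<mu> L LB \<beta>)"

lemma agss_step_size_attained:
  assumes "0 < \<mu>" "\<mu> < L" "0 < LB"
  shows "\<exists>\<beta>\<in>{0<..<1}. agss_step_size \<mu> L LB = agss_bound \<mu> L LB \<beta>"
proof -
  define u where "u \<beta> = sqrt (\<beta> * \<mu> / (L - \<mu>))" for \<beta>
  define v where "v \<beta> = (1 - \<beta>) * \<mu> / LB" for \<beta>
  have u_mono: "u a \<le> u b" if "a \<le> b" for a b
    using assms that by (simp add: u_def divide_right_mono)
  have v_anti: "v b \<le> v a" if "a \<le> b" for a b
    using assms that by (simp add: v_def divide_right_mono)
  have bound: "agss_bound \<mu> L LB \<beta> = ereal (min (u \<beta>) (v \<beta>))" for \<beta>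
    using assms by (simp add: agss_bound_def u_def v_def ereal_min)
  have "continuous_on {0..1} (\<lambda>\<beta>. u \<beta> - v \<beta>)"
    unfolding u_def v_def using assms by (intro continuous_intros) auto
  moreover have "u 0 - v 0 < 0" "0 < u 1 - v 1"
    using assms by (auto simp: u_def v_def)
  ultimately obtain b where b: "0 \<le> b" "b \<le> 1" "u b - v b = 0"
    using IVT'[of "\<lambda>\<beta>. u \<beta> - v \<beta>" 0 0 1] by auto
  have "b \<noteq> 0" "b \<noteq> 1"
    using b(3) \<open>u 0 - v 0 < 0\<close> \<open>0 < u 1 - v 1\<close> by auto
  with b have mem: "b \<in> {0<..<1}" by auto
  have "min (u \<beta>) (v \<beta>) \<le> min (u b) (v b)" for \<beta>
    using u_mono[of \<beta> b] v_anti[of b \<beta>] b(3) by linarith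
  then have "agss_bound \<mu> L LB \<beta> \<le> agss_bound \<mu> L LB b" for \<beta>
    by (simp only: bound ereal_less_eq)
  with mem have "agss_step_size \<mu> L LB = agss_bound \<mu> L LB b"
    unfolding agss_step_size_def by (intro antisym SUP_least SUP_upper) auto
  with mem show ?thesis by blast
qed

definition agss_step ::
  "(('n::{finite,linorder}) rvec \<Rightarrow> real) \<Rightarrow> real \<Rightarrow> 'n rmat \<Rightarrow> real \<Rightarrow>
   'n rvec \<times> 'n rvec \<Rightarrow> 'n rvec \<times> 'n rvec \<Rightarrow> bool" where
  "agss_step f \<mu> N \<alpha> = (\<lambda>(x, y) (x', y').
     (x' - x) /\<^sub>R \<alpha> = 2 *\<^sub>R y' - y - x' \<and>
     (y' - y) /\<^sub>R \<alpha> =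
       x - y' - (gradient f x + split_Bsym N *v y - 2 *\<^sub>R (split_B N *v y')) /\<^sub>R \<mu>)"


section \<open>Lyapunov functions\<close>

text \<open>Here \<open>s\<close> is the point \<open>x\<^sup>\<star>\<close>.\<close>

definition lyap_E ::
  "(('n::{finite,linorder}) rvec \<Rightarrow> real) \<Rightarrow> real \<Rightarrow> 'n rvec \<Rightarrow> 'n rvec \<Rightarrow> 'n rvec \<Rightarrow> real" where
  "lyap_E f \<mu> s x y = bregman (quad_shift f \<mu>) x s + \<mu> / 2 * (norm (y - s))\<^sup>2"

definition lyap_E_alpha ::
  "(('n::{finite,linorder}) rvec \<Rightarrow> real) \<Rightarrow> real \<Rightarrow> 'n rmat \<Rightarrow> real \<Rightarrow> 'n rvec \<Rightarrow>
   'n rvec \<Rightarrow> 'n rvec \<Rightarrow> real" where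
  "lyap_E_alpha f \<mu> N \<alpha> s x y =
     bregman (quad_shift f \<mu>) x s
     + 1 / 2 * sqnorm_wrt (\<mu> *\<^sub>R mat 1 - \<alpha> *\<^sub>R split_Bsym N) (y - s)
     - \<alpha> * ((gradient (quad_shift f \<mu>) x - gradient (quad_shift f \<mu>) s) \<bullet> (y - s))"

text \<open>
  Discrete counterpart, for a one-step scheme \<open>R\<close> with equilibrium \<open>z\<close>, of the Lyapunov function of
  a flow: the condition \<open>-\<langle>\<nabla>V, G\<rangle> \<ge> 0\<close> becomes decrease of \<open>V\<close> along every step, from every point.
  Vanishing only at \<open>z\<close> is not demanded: for \<open>lyap_E_alpha\<close> at the step size above it fails already
  in dimension \<open>2\<close> for \<open>f x = L / 2 * (norm x)\<^sup>2\<close> with \<open>L > \<mu>\<close>.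
\<close>

definition discrete_lyapunov :: "('z \<Rightarrow> 'z \<Rightarrow> bool) \<Rightarrow> 'z \<Rightarrow> ('z \<Rightarrow> real) \<Rightarrow> bool" where
  "discrete_lyapunov R z V \<longleftrightarrow>
     R z z \<and> V z = 0 \<and> (\<forall>w. 0 \<le> V w) \<and> (\<forall>w w'. R w w' \<longrightarrow> V w' \<le> V w)"

end

theory Submission
  imports Defs
begin

text \<open>
  Write \<open>g\<close> for \<open>quad_shift f \<mu>\<close>, a convex function whose gradient is \<open>(L - \<mu>)\<close>-Lipschitz, and
  \<open>s\<close> for the equilibrium.  Along the flow \<open>x' = y - x\<close>,
  \<open>y' = - (\<nabla>g(x) + \<mu> y + N y) / \<mu>\<close>, the energy \<open>lyap_E\<close> decreases at the rate
  \<open>Q(x, y) = (\<nabla>g(x) - \<nabla>g(s)) \<bullet> (x - s) + \<mu> * (norm (y - s))\<^sup>2\<close>: the coupling terms cancel, and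
  \<open>N\<close> does no work because it is skew-symmetric.

  The scheme splits \<open>N\<close> as \<open>B\<^sup>s\<^sup>y\<^sup>m - 2 * B\<close>.  It evaluates \<open>\<nabla>g\<close> and \<open>B\<^sup>s\<^sup>y\<^sup>m\<close> at the old point
  and only the triangular part \<open>2 * B\<close> at the new one, and the two corrections in \<open>lyap_E_alpha\<close>
  are exactly the boundary terms left over by that delay: expanding the change of
  \<open>lyap_E_alpha\<close> over a step (\<open>lyap_E_alpha_step_identity\<close>) gives \<open>- \<alpha> * Q\<close> at the
  new point minus a remainder.  The remainder consists of a Bregman divergence of \<open>g\<close>, a quadratic form
  in the increment of \<open>y\<close>, and a cross term pairing the increment of \<open>\<nabla>g\<close> with that of \<open>y\<close>.

  One inequality controls everything (\<open>cross_term_absorbed\<close>): if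
  \<open>(L - \<mu>) * \<alpha>\<^sup>2 + \<alpha> * LB \<le> \<mu>\<close> with \<open>LB\<close> the norm of \<open>B\<^sup>s\<^sup>y\<^sup>m\<close>, as the choice of step size
  ensures, a cross term \<open>\<alpha> * ((\<nabla>g(u) - \<nabla>g(u')) \<bullet> v)\<close> is at most the Bregman divergence from \<open>u'\<close> to \<open>u\<close> plus
  half of the quadratic form \<open>\<mu> I \<plusminus> \<alpha> B\<^sup>s\<^sup>y\<^sup>m\<close> at \<open>v\<close>.  It shows that the remainder is nonnegative,
  that \<open>lyap_E_alpha\<close> is nonnegative, and that \<open>lyap_E_alpha \<le> Q\<close>.  Hence
  \<open>(1 + \<alpha>) * lyap_E_alpha\<close> at the new point is at most \<open>lyap_E_alpha\<close> at the old one, which gives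
  the linear rate; and since also \<open>lyap_E \<le> Q\<close>, the last step of the iteration bounds \<open>\<alpha> * lyap_E\<close>
  at the new point by \<open>lyap_E_alpha\<close> at the old one.
\<close>

section \<open>Smooth and strongly convex functions\<close>

lemma gderiv_along_line:
  fixes h :: "'a::real_inner \<Rightarrow> real"
  assumes "GDERIV h (x + t *\<^sub>R d) :> D"
  shows "((\<lambda>s. h (x + s *\<^sub>R d)) has_real_derivative D \<bullet> d) (at t)"
proof -
  have "((\<lambda>s. x + s *\<^sub>R d) has_derivative (\<lambda>s. s *\<^sub>R d)) (at t)"
    by (auto intro!: derivative_eq_intros)
  from has_derivative_compose[OF this assms[unfolded gderiv_def]]
  show ?thesis
    unfolding has_field_derivative_def by (simp add: inner_commute mult.commute[of _ "D \<bullet> d"])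
qed

lemma convex_above_tangent:
  fixes h :: "'a::real_inner \<Rightarrow> real"
  assumes convex: "convex_on UNIV h" and deriv: "GDERIV h x :> D"
  shows "h x + D \<bullet> (z - x) \<le> h z"
proof -
  define \<phi> where "\<phi> s = h (x + s *\<^sub>R (z - x))" for s
  have "convex_on UNIV \<phi>"
  proof (rule convex_onI)
    fix t a b :: real
    assume "0 < t" "t < 1"
    moreover have "x + ((1 - t) * a + t * b) *\<^sub>R (z - x)
        = (1 - t) *\<^sub>R (x + a *\<^sub>R (z - x)) + t *\<^sub>R (x + b *\<^sub>R (z - x))"
      by (simp add: algebra_simps)
    ultimately show "\<phi> ((1 - t) *\<^sub>R a + t *\<^sub>R b) \<le> (1 - t) * \<phi> a + t * \<phi> b"
      unfolding \<phi>_def using convex_onD[OF convex] by simp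
  qed simp
  moreover have "(\<phi> has_real_derivative D \<bullet> (z - x)) (at 0 within UNIV)"
    unfolding \<phi>_def using deriv by (auto intro: gderiv_along_line)
  ultimately have "(D \<bullet> (z - x)) * (1 - 0) \<le> \<phi> 1 - \<phi> 0"
    by (intro convex_on_imp_above_tangent[where A = UNIV]) auto
  then show ?thesis by (simp add: \<phi>_def)
qed

lemma smooth_below_quadratic:
  fixes f :: "'a::real_inner \<Rightarrow> real"
  assumes "smooth L f"
  shows "f (x + d) \<le> f x + gradient f x \<bullet> d + L / 2 * (norm d)\<^sup>2"
proof -
  define \<phi> where "\<phi> t = f (x + t *\<^sub>R d) - t * (gradient f x \<bullet> d) - L / 2 * t\<^sup>2 * (norm d)\<^sup>2" for t
  have slope: "\<exists>m. (\<phi> has_real_derivative m) (at t) \<and> m \<le> 0" if "0 \<le> t" "t \<le> 1" for t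
  proof (intro exI conjI)
    have "GDERIV f (x + t *\<^sub>R d) :> gradient f (x + t *\<^sub>R d)"
      using assms by (simp add: smooth_def)
    from gderiv_along_line[OF this]
    show "(\<phi> has_real_derivative
        gradient f (x + t *\<^sub>R d) \<bullet> d - gradient f x \<bullet> d - L * t * (norm d)\<^sup>2) (at t)"
      unfolding \<phi>_def by (auto intro!: derivative_eq_intros)
    have "(gradient f (x + t *\<^sub>R d) - gradient f x) \<bullet> d
        \<le> norm (gradient f (x + t *\<^sub>R d) - gradient f x) * norm d"
      by (rule norm_cauchy_schwarz)
    also have "\<dots> \<le> (L * norm (t *\<^sub>R d)) * norm d"
      using assms lipschitz_onD[of L UNIV "gradient f" "x + t *\<^sub>R d" x]
      by (intro mult_right_mono) (auto simp: smooth_def dist_norm)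
    also have "\<dots> = L * t * (norm d)\<^sup>2"
      using that by (simp add: power2_eq_square)
    finally show "gradient f (x + t *\<^sub>R d) \<bullet> d - gradient f x \<bullet> d - L * t * (norm d)\<^sup>2 \<le> 0"
      by (simp add: inner_diff_left)
  qed
  have "\<phi> 1 \<le> \<phi> 0"
    by (rule DERIV_nonpos_imp_nonincreasing[OF _ slope]) simp_all
  then show ?thesis by (simp add: \<phi>_def)
qed

lemma gderiv_quad_shift:
  assumes "GDERIV f x :> D"
  shows "GDERIV (quad_shift f \<mu>) x :> D - \<mu> *\<^sub>R x"
  using assms unfolding gderiv_def quad_shift_def power2_norm_eq_inner
  by (auto intro!: derivative_eq_intros simp: inner_commute algebra_simps)

lemma gradient_quad_shift:
  assumes "smooth L f"
  shows "gradient (quad_shift f \<mu>) x = gradient f x - \<mu> *\<^sub>R x"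
  using assms by (intro gradient_eqI gderiv_quad_shift) (simp add: smooth_def)

text \<open>
  Lower bounds on the Bregman divergence come from comparing \<open>g (y - w)\<close> with the tangent plane at
  \<open>x\<close> from below and with the quadratic majorant at \<open>y\<close> from above.  Maximising over \<open>w\<close>
  would give the co-coercivity bound \<open>(norm (\<nabla>g(y) - \<nabla>g(x)))\<^sup>2 / (2 * (L - \<mu>))\<close>; keeping \<open>w\<close> free
  avoids the division, so that \<open>L = \<mu>\<close> is covered, and already has the shape of Young's inequality in
  which the bound is needed.
\<close>

lemma bregman_ge_gradient_difference:
  fixes f :: "'a::real_inner \<Rightarrow> real"
  assumes convex: "strongly_convex \<mu> f" and smooth: "smooth L f"
  defines "g \<equiv> quad_shift f \<mu>"
  shows "(gradient g y - gradient g x) \<bullet> w - (L - \<mu>) / 2 * (norm w)\<^sup>2 \<le> bregman g y x"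
proof -
  have grad: "gradient g z = gradient f z - \<mu> *\<^sub>R z" for z
    unfolding g_def by (rule gradient_quad_shift[OF smooth])
  have "GDERIV g x :> gradient g x"
    using gderiv_quad_shift[of f x "gradient f x" \<mu>] smooth
    by (simp add: smooth_def grad) (simp add: g_def)
  with convex have above: "g x + gradient g x \<bullet> (y - w - x) \<le> g (y - w)"
    unfolding strongly_convex_def g_def by (rule convex_above_tangent)
  have "f (y - w) \<le> f y - gradient f y \<bullet> w + L / 2 * (norm w)\<^sup>2"
    using smooth_below_quadratic[OF smooth, of y "- w"] by simp
  moreover have "\<mu> / 2 * (norm (y - w))\<^sup>2
      = \<mu> / 2 * (norm y)\<^sup>2 - \<mu> * (y \<bullet> w) + \<mu> / 2 * (norm w)\<^sup>2"
    unfolding power2_norm_eq_inner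
    by (simp add: inner_diff_left inner_diff_right inner_commute[of w y] field_simps)
  moreover have "(L - \<mu>) / 2 * (norm w)\<^sup>2 = L / 2 * (norm w)\<^sup>2 - \<mu> / 2 * (norm w)\<^sup>2"
    by (simp add: field_simps)
  moreover have "gradient g y \<bullet> w = gradient f y \<bullet> w - \<mu> * (y \<bullet> w)"
    by (simp add: grad inner_diff_left)
  ultimately have "g (y - w) \<le> g y - gradient g y \<bullet> w + (L - \<mu>) / 2 * (norm w)\<^sup>2"
    unfolding g_def quad_shift_def by linarith
  with above show ?thesis
    by (simp add: bregman_def inner_diff_left inner_diff_right)
qed

text \<open>
  At \<open>x = y\<close> the previous bound says \<open>0 \<le> (L - \<mu>) * (norm w)\<^sup>2\<close>, so a single nonzero vector \<open>w\<close>
  suffices.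
\<close>

lemma strong_convexity_le_smoothness:
  fixes f :: "'a::euclidean_space \<Rightarrow> real"
  assumes "strongly_convex \<mu> f" and "smooth L f"
  shows "\<mu> \<le> L"
proof -
  obtain w :: 'a where "w \<in> Basis" using nonempty_Basis by blast
  with bregman_ge_gradient_difference[OF assms, of 0 0 w] show ?thesis
    by (simp add: bregman_def)
qed


section \<open>The step size\<close>

lemma agss_step_size_pos:
  assumes "0 < \<mu>" "\<mu> \<le> L" "0 \<le> LB" "ereal \<alpha> = agss_step_size \<mu> L LB"
  shows "0 < \<alpha>"
proof -
  have "0 < agss_bound \<mu> L LB (1 / 2)"
    using assms by (simp add: agss_bound_def)
  also have "\<dots> \<le> agss_step_size \<mu> L LB"
    unfolding agss_step_size_def by (rule SUP_upper) simp
  finally show ?thesis by (simp flip: assms(4))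
qed

text \<open>
  The bounds defining the step size say \<open>(L - \<mu>) * \<alpha>\<^sup>2 \<le> \<beta> * \<mu>\<close> and
  \<open>\<alpha> * LB \<le> (1 - \<beta>) * \<mu>\<close>; their sum no longer mentions \<open>\<beta>\<close>.  It is also stable under the
  passage to the limits \<open>\<beta> = 1\<close> and \<open>\<beta> = 0\<close>, which are the relevant ones when \<open>LB\<close> or
  \<open>L - \<mu>\<close> vanishes.
\<close>

lemma agss_step_size_admissible:
  assumes "0 < \<mu>" "\<mu> \<le> L" "0 \<le> LB" "ereal \<alpha> = agss_step_size \<mu> L LB"
  shows "(L - \<mu>) * \<alpha>\<^sup>2 + \<alpha> * LB \<le> \<mu>"
proof -
  have pos: "0 < \<alpha>" using assms by (rule agss_step_size_pos)
  have from_sqrt: "(L - \<mu>) * \<alpha>\<^sup>2 \<le> \<beta> * \<mu>"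
    if "\<mu> < L" "0 < \<beta>" "\<alpha> \<le> sqrt (\<beta> * \<mu> / (L - \<mu>))" for \<beta>
  proof -
    have "\<alpha>\<^sup>2 \<le> \<beta> * \<mu> / (L - \<mu>)"
      using that assms(1) pos power_mono[OF that(3), of 2] by simp
    then show ?thesis using that(1) by (simp add: field_simps)
  qed
  consider "\<mu> < L" "0 < LB" | "\<mu> < L" "LB = 0" | "L = \<mu>" "0 < LB" | "L = \<mu>" "LB = 0"
    using assms by linarith
  then show ?thesis
  proof cases
    case 1
    then obtain \<beta> where "\<beta> \<in> {0<..<1}" "ereal \<alpha> = agss_bound \<mu> L LB \<beta>"
      using agss_step_size_attained[of \<mu> L LB] assms by auto
    then have \<beta>: "0 < \<beta>" "\<alpha> \<le> sqrt (\<beta> * \<mu> / (L - \<mu>))" "\<alpha> \<le> (1 - \<beta>) * \<mu> / LB"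
      using 1 by (auto simp: agss_bound_def min_def split: if_splits)
    have "\<alpha> * LB \<le> (1 - \<beta>) * \<mu>"
      using \<beta>(3) 1 by (simp add: field_simps)
    with from_sqrt[OF 1(1) \<beta>(1,2)] show ?thesis by (simp add: algebra_simps)
  next
    case 2
    then have "agss_bound \<mu> L LB \<beta> \<le> ereal (sqrt (1 * \<mu> / (L - \<mu>)))" if "\<beta> \<in> {0<..<1}" for \<beta>
      using that assms by (simp add: agss_bound_def divide_right_mono)
    then have "ereal \<alpha> \<le> ereal (sqrt (1 * \<mu> / (L - \<mu>)))"
      unfolding assms(4) agss_step_size_def by (intro SUP_least)
    then show ?thesis using from_sqrt[of 1] 2 by simp
  next
    case 3
    then have "agss_bound \<mu> L LB \<beta> \<le> ereal (\<mu> / LB)" if "\<beta> \<in> {0<..<1}" for \<beta>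
      using that assms by (simp add: agss_bound_def divide_right_mono)
    then have "ereal \<alpha> \<le> ereal (\<mu> / LB)"
      unfolding assms(4) agss_step_size_def by (intro SUP_least)
    then show ?thesis using 3 by (simp add: field_simps)
  next
    case 4
    then have "agss_step_size \<mu> L LB = \<infinity>"
      by (simp add: agss_step_size_def agss_bound_def)
    with assms(4) show ?thesis by simp
  qed
qed


section \<open>The symmetric part of the splitting\<close>

lemma split_Bsym_self_adjoint: "(split_Bsym N *v u) \<bullet> v = u \<bullet> (split_Bsym N *v v)"
proof -
  have "transpose (split_Bsym N) = split_Bsym N"
    by (simp add: split_Bsym_def transpose_def vec_eq_iff)
  then show ?thesis by (metis dot_lmul_matrix vector_transpose_matrix)
qed

lemma split_Bsym_quadratic_form: "(split_Bsym N *v v) \<bullet> v = 2 * ((split_B N *v v) \<bullet> v)"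
proof -
  have "(transpose (split_B N) *v v) \<bullet> v = (split_B N *v v) \<bullet> v"
    by (metis dot_lmul_matrix vector_transpose_matrix inner_commute transpose_transpose)
  then show ?thesis
    by (simp add: split_Bsym_def matrix_vector_mult_add_rdistrib inner_add_left)
qed

text \<open>
  Hence an equilibrium of the flow is a fixed point of the scheme, although the scheme evaluates
  the two parts of \<open>N\<close> at different points.
\<close>

lemma split_Bsym_minus_2_split_B:
  assumes "skew_symmetric N"
  shows "split_Bsym N *v v - 2 *\<^sub>R (split_B N *v v) = N *v v"
  unfolding skew_symmetric_splitting[OF assms, THEN arg_cong, of "\<lambda>M. M *v v"]
  by (simp add: split_Bsym_def matrix_vector_mult_add_rdistrib
      matrix_vector_mult_diff_rdistrib scaleR_2)

lemma quadratic_form_le_op_norm: "\<bar>(A *v v) \<bullet> v\<bar> \<le> op_norm A * (norm v)\<^sup>2"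
proof -
  have "\<bar>(A *v v) \<bullet> v\<bar> \<le> norm (A *v v) * norm v"
    by (rule Cauchy_Schwarz_ineq2)
  also have "\<dots> \<le> (op_norm A * norm v) * norm v"
    unfolding op_norm_def
    by (intro mult_right_mono onorm matrix_vector_mul_bounded_linear) simp
  finally show ?thesis by (simp add: power2_eq_square mult.assoc)
qed

lemma sqnorm_wrt_shift:
  "sqnorm_wrt (\<mu> *\<^sub>R mat 1 - \<alpha> *\<^sub>R M) v = \<mu> * (norm v)\<^sup>2 - \<alpha> * ((M *v v) \<bullet> v)"
  by (simp add: sqnorm_wrt_def matrix_vector_mult_diff_rdistrib inner_diff_left
      scaleR_matrix_vector_assoc[symmetric] power2_norm_eq_inner)


section \<open>One step of the scheme\<close>

text \<open>
  Measured from the equilibrium, the scheme is homogeneous, and \<open>\<nabla>f\<close> is replaced by \<open>\<nabla>g\<close>: the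
  difference \<open>\<mu> x\<close> of the two gradients cancels against the term \<open>x\<close> in the second equation.
\<close>

lemma agss_step_about_equilibrium:
  assumes "0 < \<mu>" "\<alpha> \<noteq> 0" and smooth: "smooth L f" and skew: "skew_symmetric N"
    and equilibrium: "gradient f s + N *v s = 0"
    and step: "agss_step f \<mu> N \<alpha> (x, y) (x', y')"
  defines "g \<equiv> quad_shift f \<mu>"
  shows "(x' - s) - (x - s) = \<alpha> *\<^sub>R (2 *\<^sub>R (y' - s) - (y - s) - (x' - s))"
    and "\<mu> *\<^sub>R ((y' - s) - (y - s))
       = - \<alpha> *\<^sub>R (\<mu> *\<^sub>R (y' - s) + (gradient g x - gradient g s)
           + split_Bsym N *v (y - s) - 2 *\<^sub>R (split_B N *v (y' - s)))"
proof -
  have 1: "(x' - x) /\<^sub>R \<alpha> = 2 *\<^sub>R y' - y - x'"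
    and 2: "(y' - y) /\<^sub>R \<alpha> =
       x - y' - (gradient f x + split_Bsym N *v y - 2 *\<^sub>R (split_B N *v y')) /\<^sub>R \<mu>"
    using step by (auto simp: agss_step_def)
  have "x' - x = \<alpha> *\<^sub>R (2 *\<^sub>R y' - y - x')"
    using \<open>\<alpha> \<noteq> 0\<close> by (simp flip: 1)
  then show "(x' - s) - (x - s) = \<alpha> *\<^sub>R (2 *\<^sub>R (y' - s) - (y - s) - (x' - s))"
    by (simp add: algebra_simps scaleR_2)
  have Ns: "split_Bsym N *v s - 2 *\<^sub>R (split_B N *v s) = - gradient f s"
    using equilibrium split_Bsym_minus_2_split_B[OF skew, of s] by (simp add: eq_neg_iff_add_eq_0 add.commute)
  have "\<mu> *\<^sub>R (y' - y) = \<alpha> *\<^sub>R \<mu> *\<^sub>R ((y' - y) /\<^sub>R \<alpha>)"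
    using \<open>\<alpha> \<noteq> 0\<close> by simp
  also have "\<mu> *\<^sub>R ((y' - y) /\<^sub>R \<alpha>)
      = \<mu> *\<^sub>R (x - y') - (gradient f x + split_Bsym N *v y - 2 *\<^sub>R (split_B N *v y'))"
    using \<open>0 < \<mu>\<close> unfolding 2 by (simp add: scaleR_diff_right)
  also have "\<dots> = - (\<mu> *\<^sub>R (y' - s) + (gradient g x - gradient g s)
           + split_Bsym N *v (y - s) - 2 *\<^sub>R (split_B N *v (y' - s)))"
    using Ns unfolding g_def gradient_quad_shift[OF smooth]
    by (simp add: algebra_simps)
  finally show "\<mu> *\<^sub>R ((y' - s) - (y - s))
       = - \<alpha> *\<^sub>R (\<mu> *\<^sub>R (y' - s) + (gradient g x - gradient g s)
           + split_Bsym N *v (y - s) - 2 *\<^sub>R (split_B N *v (y' - s)))"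
    by (simp only: scaleR_minus_left scaleR_minus_right diff_diff_eq2 diff_add_cancel)
qed

text \<open>
  The rate at which \<open>lyap_E\<close> decreases along the continuous flow; the discrete scheme dissipates
  at least \<open>\<alpha>\<close> times this amount of \<open>lyap_E_alpha\<close>, evaluated at the new point.
\<close>

definition dissipation ::
  "('a::real_inner \<Rightarrow> real) \<Rightarrow> real \<Rightarrow> 'a \<Rightarrow> 'a \<Rightarrow> 'a \<Rightarrow> real" where
  "dissipation f \<mu> s u v =
     (gradient (quad_shift f \<mu>) u - gradient (quad_shift f \<mu>) s) \<bullet> (u - s) + \<mu> * (norm (v - s))\<^sup>2"

lemma dissipation_eq_bregman:
  "dissipation f \<mu> s u v =
     bregman (quad_shift f \<mu>) u s + bregman (quad_shift f \<mu>) s u + \<mu> * (norm (v - s))\<^sup>2"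
  by (simp add: dissipation_def bregman_def inner_diff_left inner_diff_right)

text \<open>
  The Bregman divergence changes by \<open>\<nabla>g(x') \<bullet> (x' - x)\<close> up to the divergence from \<open>x'\<close> to \<open>x\<close>, and
  the quadratic part by \<open>(\<mu> I - \<alpha> B\<^sup>s\<^sup>y\<^sup>m) (y' - y) \<bullet> (y' - s)\<close> up to half the quadratic form of the
  increment.  Inserting the two equations of the scheme, the correction \<open>- \<alpha> B\<^sup>s\<^sup>y\<^sup>m\<close> removes the delay
  of \<open>B\<^sup>s\<^sup>y\<^sup>m y\<close>, and the gradient correction turns the delay of \<open>\<nabla>g\<close> into a product of increments,
  thanks to the extrapolation \<open>2 * y' - y\<close> in the first equation.
\<close>

lemma lyap_E_alpha_step_identity:
  assumes "0 < \<mu>" "\<alpha> \<noteq> 0" and smooth: "smooth L f" and skew: "skew_symmetric N"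
    and equilibrium: "gradient f s + N *v s = 0"
    and step: "agss_step f \<mu> N \<alpha> (x, y) (x', y')"
  defines "g \<equiv> quad_shift f \<mu>"
  shows "lyap_E_alpha f \<mu> N \<alpha> s x' y' - lyap_E_alpha f \<mu> N \<alpha> s x y
    = - \<alpha> * dissipation f \<mu> s x' y'
      - (bregman g x x' - (gradient g x - gradient g x') \<bullet> (\<alpha> *\<^sub>R (y - y'))
         + 1 / 2 * sqnorm_wrt (\<mu> *\<^sub>R mat 1 - \<alpha> *\<^sub>R split_Bsym N) (y - y'))"
proof -
  define X X' Y Y' where "X = x - s" and "X' = x' - s" and "Y = y - s" and "Y' = y' - s"
  define G G' where "G = gradient g x - gradient g s" and "G' = gradient g x' - gradient g s"
  define S where "S = split_Bsym N"
  note step' = agss_step_about_equilibrium[OF assms(1-6), folded g_def]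
  have x_step: "X' - X = \<alpha> *\<^sub>R (2 *\<^sub>R Y' - Y - X')"
    using step'(1) by (simp add: X_def X'_def Y_def Y'_def)
  have y_step: "\<mu> *\<^sub>R (Y' - Y) = - \<alpha> *\<^sub>R (\<mu> *\<^sub>R Y' + G + S *v Y - 2 *\<^sub>R (split_B N *v Y'))"
    using step'(2) by (simp add: G_def S_def Y_def Y'_def)
  have sym: "(S *v Y') \<bullet> Y = (S *v Y) \<bullet> Y'"
    unfolding S_def by (metis split_Bsym_self_adjoint inner_commute)
  have "G' \<bullet> (X' - X) = \<alpha> * (2 * (G' \<bullet> Y') - G' \<bullet> Y - G' \<bullet> X')"
    unfolding x_step by (simp add: inner_diff_right)
  then have potential: "bregman g x' s - bregman g x s
      = \<alpha> * (2 * (G' \<bullet> Y') - G' \<bullet> Y - G' \<bullet> X') - bregman g x x'"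
    by (simp add: bregman_def G'_def X_def X'_def inner_diff_left inner_diff_right)
  have "\<mu> * ((Y' - Y) \<bullet> Y') = (\<mu> *\<^sub>R (Y' - Y)) \<bullet> Y'" by simp
  \<comment> \<open>\<open>2 * B\<close> and \<open>B\<^sup>s\<^sup>y\<^sup>m\<close> have the same quadratic form, so the implicit term becomes \<open>(S *v Y') \<bullet> Y'\<close>.\<close>
  also have "\<dots> = - \<alpha> * (\<mu> * (Y' \<bullet> Y') + G \<bullet> Y' + (S *v Y) \<bullet> Y' - (S *v Y') \<bullet> Y')"
    unfolding y_step S_def split_Bsym_quadratic_form
    by (simp add: inner_diff_left inner_add_left)
  finally have kinetic: "\<mu> * (Y' \<bullet> Y') - \<mu> * (Y \<bullet> Y')
      = - \<alpha> * (\<mu> * (Y' \<bullet> Y') + G \<bullet> Y' + (S *v Y) \<bullet> Y' - (S *v Y') \<bullet> Y')"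
    by (simp add: inner_diff_left algebra_simps)
  have diffs: "y - y' = Y - Y'" "gradient g x - gradient g x' = G - G'"
    by (simp_all add: Y_def Y'_def G_def G'_def)
  have "lyap_E_alpha f \<mu> N \<alpha> s x' y' - lyap_E_alpha f \<mu> N \<alpha> s x y
      = (bregman g x' s - bregman g x s)
        + 1 / 2 * (\<mu> * (Y' \<bullet> Y') - \<alpha> * ((S *v Y') \<bullet> Y'))
        - 1 / 2 * (\<mu> * (Y \<bullet> Y) - \<alpha> * ((S *v Y) \<bullet> Y)) - \<alpha> * (G' \<bullet> Y') + \<alpha> * (G \<bullet> Y)"
    unfolding lyap_E_alpha_def sqnorm_wrt_shift power2_norm_eq_inner
    by (simp add: g_def G_def G'_def S_def Y_def Y'_def)
  also have "\<dots> = - \<alpha> * (G' \<bullet> X' + \<mu> * (Y' \<bullet> Y'))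
      - (bregman g x x' - (G - G') \<bullet> (\<alpha> *\<^sub>R (Y - Y'))
         + 1 / 2 * (\<mu> * ((Y - Y') \<bullet> (Y - Y')) - \<alpha> * ((S *v (Y - Y')) \<bullet> (Y - Y'))))"
    using potential kinetic sym
    by (simp add: inner_diff_left inner_diff_right matrix_vector_mult_diff_distrib
        inner_commute[of Y' Y] field_simps)
  finally show ?thesis
    unfolding sqnorm_wrt_shift power2_norm_eq_inner diffs S_def[symmetric]
    by (simp add: dissipation_def g_def G'_def X'_def Y'_def power2_norm_eq_inner)
qed

section \<open>Consequences of an admissible step size\<close>

text \<open>
  Taking \<open>w = \<alpha> *\<^sub>R v\<close> in \<open>bregman_ge_gradient_difference\<close> leaves an error
  \<open>(L - \<mu>) / 2 * \<alpha>\<^sup>2 * (norm v)\<^sup>2\<close>, which an admissible \<open>\<alpha>\<close> makes smaller than the quadratic form.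
  The form enters only through \<open>r\<close>, because it is needed with both signs of \<open>B\<^sup>s\<^sup>y\<^sup>m\<close>.
\<close>

lemma cross_term_absorbed:
  fixes f :: "'a::real_inner \<Rightarrow> real"
  assumes convex: "strongly_convex \<mu> f" and smooth: "smooth L f"
    and admissible: "(L - \<mu>) * \<alpha>\<^sup>2 + \<alpha> * LB \<le> \<mu>" and r: "\<bar>r\<bar> \<le> \<alpha> * (LB * (norm v)\<^sup>2)"
  defines "g \<equiv> quad_shift f \<mu>"
  shows "\<alpha> * ((gradient g u - gradient g u') \<bullet> v) \<le> bregman g u u' + 1 / 2 * (\<mu> * (norm v)\<^sup>2 + r)"
proof -
  have combine: "i \<le> d + 1 / 2 * (m + r)" if "i - 1 / 2 * l \<le> d" "l + \<bar>r\<bar> \<le> m"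
    for d i l m :: real
    using that by (simp add: field_simps)
  show ?thesis
  proof (rule combine)
    show "\<alpha> * ((gradient g u - gradient g u') \<bullet> v)
        - 1 / 2 * ((L - \<mu>) * (norm (\<alpha> *\<^sub>R v))\<^sup>2) \<le> bregman g u u'"
      using bregman_ge_gradient_difference[OF convex smooth, of u u' "\<alpha> *\<^sub>R v"]
      unfolding g_def by simp
    have "(L - \<mu>) * (norm (\<alpha> *\<^sub>R v))\<^sup>2 + \<bar>r\<bar>
        \<le> (L - \<mu>) * (norm (\<alpha> *\<^sub>R v))\<^sup>2 + \<alpha> * (LB * (norm v)\<^sup>2)"
      using r by simp
    also have "\<dots> = ((L - \<mu>) * \<alpha>\<^sup>2 + \<alpha> * LB) * (norm v)\<^sup>2"
      by (simp add: algebra_simps power_mult_distrib)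
    also have "\<dots> \<le> \<mu> * (norm v)\<^sup>2"
      by (intro mult_right_mono admissible) simp
    finally show "(L - \<mu>) * (norm (\<alpha> *\<^sub>R v))\<^sup>2 + \<bar>r\<bar> \<le> \<mu> * (norm v)\<^sup>2" .
  qed
qed

lemma scaled_quadratic_form_bound:
  assumes "0 < \<alpha>"
  shows "\<bar>\<alpha> * ((A *v v) \<bullet> v)\<bar> \<le> \<alpha> * (op_norm A * (norm v)\<^sup>2)"
  using assms quadratic_form_le_op_norm[of A v] by (simp add: abs_mult)

lemma lyap_E_alpha_nonneg:
  fixes f :: "('n::{finite,linorder}) rvec \<Rightarrow> real"
  assumes "strongly_convex \<mu> f" "smooth L f" "0 < \<alpha>"
    and "(L - \<mu>) * \<alpha>\<^sup>2 + \<alpha> * op_norm (split_Bsym N) \<le> \<mu>"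
  shows "0 \<le> lyap_E_alpha f \<mu> N \<alpha> s u v"
  using cross_term_absorbed[OF assms(1,2,4), of "- (\<alpha> * ((split_Bsym N *v (v - s)) \<bullet> (v - s)))" "v - s" u s]
    scaled_quadratic_form_bound[OF assms(3), of "split_Bsym N" "v - s"]
  unfolding lyap_E_alpha_def sqnorm_wrt_shift by simp

text \<open>
  The difference \<open>dissipation - lyap_E_alpha\<close> has the same form as \<open>lyap_E_alpha\<close>, with the divergence
  taken from \<open>u\<close> to \<open>s\<close> and with the opposite sign of \<open>B\<^sup>s\<^sup>y\<^sup>m\<close>.
\<close>

lemma lyap_E_alpha_le_dissipation:
  fixes f :: "('n::{finite,linorder}) rvec \<Rightarrow> real"
  assumes "strongly_convex \<mu> f" "smooth L f" "0 < \<alpha>"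
    and "(L - \<mu>) * \<alpha>\<^sup>2 + \<alpha> * op_norm (split_Bsym N) \<le> \<mu>"
  shows "lyap_E_alpha f \<mu> N \<alpha> s u v \<le> dissipation f \<mu> s u v"
  using cross_term_absorbed[OF assms(1,2,4), of "\<alpha> * ((split_Bsym N *v (v - s)) \<bullet> (v - s))" "v - s" s u]
    scaled_quadratic_form_bound[OF assms(3), of "split_Bsym N" "v - s"]
  unfolding lyap_E_alpha_def sqnorm_wrt_shift dissipation_eq_bregman
  by (simp add: inner_diff_left algebra_simps)

lemma lyap_E_le_dissipation:
  fixes f :: "('n::{finite,linorder}) rvec \<Rightarrow> real"
  assumes "0 < \<mu>" "strongly_convex \<mu> f" "smooth L f"
  shows "lyap_E f \<mu> s u v \<le> dissipation f \<mu> s u v"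
proof -
  have "0 \<le> bregman (quad_shift f \<mu>) s u"
    using bregman_ge_gradient_difference[OF assms(2,3), of s u 0] by simp
  moreover have "\<mu> / 2 * (norm (v - s))\<^sup>2 \<le> \<mu> * (norm (v - s))\<^sup>2"
    using \<open>0 < \<mu>\<close> by (intro mult_right_mono) auto
  ultimately show ?thesis
    unfolding lyap_E_def dissipation_eq_bregman by simp
qed

lemma lyap_E_alpha_decrease:
  fixes f :: "('n::{finite,linorder}) rvec \<Rightarrow> real"
  assumes "0 < \<mu>" "strongly_convex \<mu> f" "smooth L f" "skew_symmetric N"
    and "gradient f s + N *v s = 0" "0 < \<alpha>"
    and "(L - \<mu>) * \<alpha>\<^sup>2 + \<alpha> * op_norm (split_Bsym N) \<le> \<mu>"
    and step: "agss_step f \<mu> N \<alpha> (u, v) (u', v')"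
  shows "lyap_E_alpha f \<mu> N \<alpha> s u' v' + \<alpha> * dissipation f \<mu> s u' v' \<le> lyap_E_alpha f \<mu> N \<alpha> s u v"
  using lyap_E_alpha_step_identity[OF assms(1) _ assms(3-5) step] \<open>0 < \<alpha>\<close>
    cross_term_absorbed[OF assms(2,3,7), of "- (\<alpha> * ((split_Bsym N *v (v - v')) \<bullet> (v - v')))" "v - v'" u u']
    scaled_quadratic_form_bound[OF assms(6), of "split_Bsym N" "v - v'"]
  unfolding sqnorm_wrt_shift by simp

theorem theorem7p1:
  fixes f :: "('n::{finite,linorder}) rvec \<Rightarrow> real"
    and N :: "'n rmat"
    and \<mu> L \<alpha> :: real
    and x_star :: "'n rvec"
    and x y :: "nat \<Rightarrow> 'n rvec"
  assumes "0 < \<mu>"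
    and "strongly_convex \<mu> f"
    and "smooth L f"
    and "skew_symmetric N"
    and "gradient f x_star + N *v x_star = 0"
    and "ereal \<alpha> = agss_step_size \<mu> L (op_norm (split_Bsym N))"
    and "\<And>k. agss_step f \<mu> N \<alpha> (x k, y k) (x (Suc k), y (Suc k))"
  shows "discrete_lyapunov (agss_step f \<mu> N \<alpha>) (x_star, x_star)
           (\<lambda>(u, v). lyap_E_alpha f \<mu> N \<alpha> x_star u v)
    \<and> (\<forall>k. lyap_E_alpha f \<mu> N \<alpha> x_star (x (Suc k)) (y (Suc k))
           \<le> (1 / (1 + \<alpha>)) ^ (k + 1) * lyap_E_alpha f \<mu> N \<alpha> x_star (x 0) (y 0))
    \<and> (\<forall>k. lyap_E f \<mu> x_star (x (Suc k)) (y (Suc k))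
           \<le> 1 / \<alpha> * (1 / (1 + \<alpha>)) ^ k * lyap_E_alpha f \<mu> N \<alpha> x_star (x 0) (y 0))"
proof -
  define V where "V = lyap_E_alpha f \<mu> N \<alpha> x_star"
  define Q where "Q = dissipation f \<mu> x_star"
  have "\<mu> \<le> L" by (rule strong_convexity_le_smoothness[OF assms(2,3)])
  have "0 \<le> op_norm (split_Bsym N)"
    unfolding op_norm_def by (intro onorm_pos_le matrix_vector_mul_bounded_linear)
  note size = \<open>0 < \<mu>\<close> \<open>\<mu> \<le> L\<close> this assms(6)
  have pos: "0 < \<alpha>" by (rule agss_step_size_pos[OF size])
  note admissible = agss_step_size_admissible[OF size]
  have V_nonneg: "0 \<le> V u v" for u v
    unfolding V_def by (rule lyap_E_alpha_nonneg[OF assms(2,3) pos admissible])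
  have V_le_Q: "V u v \<le> Q u v" for u v
    unfolding V_def Q_def by (rule lyap_E_alpha_le_dissipation[OF assms(2,3) pos admissible])
  have E_le_Q: "lyap_E f \<mu> x_star u v \<le> Q u v" for u v
    unfolding Q_def by (rule lyap_E_le_dissipation[OF assms(1-3)])
  have decrease: "V u' v' + \<alpha> * Q u' v' \<le> V u v"
    if "agss_step f \<mu> N \<alpha> (u, v) (u', v')" for u v u' v'
    unfolding V_def Q_def by (rule lyap_E_alpha_decrease[OF assms(1-5) pos admissible that])
  have contract: "V u' v' \<le> V u v / (1 + \<alpha>)"
    if "agss_step f \<mu> N \<alpha> (u, v) (u', v')" for u v u' v'
  proof -
    have "V u' v' + \<alpha> * V u' v' \<le> V u' v' + \<alpha> * Q u' v'"
      using V_le_Q pos by simp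
    also note decrease[OF that]
    finally show ?thesis using pos by (simp add: field_simps)
  qed
  have linear: "V (x k) (y k) \<le> (1 / (1 + \<alpha>)) ^ k * V (x 0) (y 0)" for k
  proof (induction k)
    case (Suc k)
    have "V (x (Suc k)) (y (Suc k)) \<le> V (x k) (y k) / (1 + \<alpha>)"
      by (rule contract[OF assms(7)])
    also have "\<dots> \<le> (1 / (1 + \<alpha>)) ^ k * V (x 0) (y 0) / (1 + \<alpha>)"
      using Suc pos by (intro divide_right_mono) auto
    finally show ?case by (simp add: mult.commute)
  qed simp
  \<comment> \<open>Only \<open>k\<close> factors \<open>1 / (1 + \<alpha>)\<close> survive: step \<open>k + 1\<close> is spent on converting \<open>V\<close> into \<open>\<alpha> * Q\<close>.\<close>
  have "lyap_E f \<mu> x_star (x (Suc k)) (y (Suc k)) \<le> 1 / \<alpha> * (1 / (1 + \<alpha>)) ^ k * V (x 0) (y 0)" for k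
  proof -
    have "\<alpha> * lyap_E f \<mu> x_star (x (Suc k)) (y (Suc k)) \<le> \<alpha> * Q (x (Suc k)) (y (Suc k))"
      using E_le_Q pos by simp
    also have "\<dots> \<le> V (x k) (y k)"
      using decrease[OF assms(7)[of k]] V_nonneg[of "x (Suc k)" "y (Suc k)"] by linarith
    also note linear[of k]
    finally show ?thesis using pos by (simp add: field_simps)
  qed
  moreover have "discrete_lyapunov (agss_step f \<mu> N \<alpha>) (x_star, x_star) (\<lambda>(u, v). V u v)"
    unfolding discrete_lyapunov_def
  proof (intro conjI allI impI)
    have "gradient f x_star + split_Bsym N *v x_star - 2 *\<^sub>R (split_B N *v x_star) = 0"
      using split_Bsym_minus_2_split_B[OF assms(4), of x_star] assms(5) by (simp add: algebra_simps)
    then show "agss_step f \<mu> N \<alpha> (x_star, x_star) (x_star, x_star)"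
      by (simp add: agss_step_def scaleR_2)
    show "(case (x_star, x_star) of (u, v) \<Rightarrow> V u v) = 0"
      by (simp add: V_def lyap_E_alpha_def bregman_def sqnorm_wrt_def)
    show "0 \<le> (case w of (u, v) \<Rightarrow> V u v)" for w
      using V_nonneg by (cases w) simp
    show "(case w' of (u, v) \<Rightarrow> V u v) \<le> (case w of (u, v) \<Rightarrow> V u v)"
      if step: "agss_step f \<mu> N \<alpha> w w'" for w w'
    proof -
      obtain u v u' v' where w: "w = (u, v)" "w' = (u', v')" by (metis surj_pair)
      have "V u' v' \<le> V u v / (1 + \<alpha>)"
        using contract step unfolding w by blast
      also have "\<dots> \<le> V u v"
        using pos V_nonneg[of u v] by (simp add: field_simps)
      finally show ?thesis by (simp add: w)
    qed
  qed
  ultimately show ?thesis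
    using linear[of "Suc k" for k] unfolding V_def by simp
qed

end
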